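(* Every solvable inductive problem is solvable by some AGM agent. That is: if $\mathbb{P}=(\mathbb{S},\mathcal{Q})$ is an inductive problem on an epistemic space $\mathbb{S}=(S,\mathcal{O})$ and some agent solves $\mathbb{P}$, then some AGM agent solves $\mathbb{P}$.
   Context: An epistemic space is a pair $\mathbb{S}=(S,\mathcal{O})$ with $S$ a set of states and $\mathcal{O}\subseteq\mathcal{P}(S)$ a countable (or finite) family of observable properties. A data sequence is a finite sequence $(\sigma_0,\dots,\sigma_n)$ of elements of $\mathcal{O}$; a data stream is an infinite sequence $\vec O=(O_0,O_1,\dots)\in\mathcal{O}^{\omega}$, and $\vec O[n]=(O_0,\dots,O_{n-1})$. A data stream for $s\in S$ is a stream $\vec O$ with $\{O\in\mathcal{O}: s\in O\}=\{O\in\mathcal{O}:\bigcap_{i=0}^n O_i\subseteq O \text{ for some } n\}$. An inductive problem is a pair $(\mathbb{S},\mathcal{Q})$ with $\mathcal{Q}$ a partition of $S$ (its cells are called answers); $A_s$ denotes the answer containing $s$. An agent $\mathcal{L}$ is a map assigning to every epistemic space $\mathbb{S}$ and every data sequence $(\sigma_0,\dots,\sigma_n)$ a family $\mathcal{L}_{\mathbb{S}}(\sigma_0,\dots,\sigma_n)\subseteq\mathcal{P}(S)$ (the propositions believed), such that $\emptyset\notin\mathcal{L}_{\mathbb{S}}(\sigma_0,\dots,\sigma_n)$ whenever $\bigcap_{i=0}^n\sigma_i\neq\emptyset$. An agent solves $(\mathbb{S},\mathcal{Q})$ if for every $s\in S$ and every data stream $\vec O$ for $s$ there is $k$ with $A_s\in\mathcal{L}_{\mathbb{S}}(\vec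 O[n])$ for all $n\ge k$; a problem is solvable if some agent solves it. An AGM agent $\mathcal{L}^{\le}$ is an agent equipped with an assignment to each epistemic space $\mathbb{S}$ of a total preorder $\le_{\mathbb{S}}$ on $S$ (reflexive, transitive, connected; not required to be well-founded), whose beliefs are $\mathcal{L}^{\le}_{\mathbb{S}}(\sigma_0,\dots,\sigma_n)=\{P\subseteq S: \exists s\in\bigcap_{i=0}^n\sigma_i\ \forall t\in\bigcap_{i=0}^n\sigma_i\ (t\le_{\mathbb{S}} s\Rightarrow t\in P)\}$.
   Formalization: Agents are also required to have pairwise intersecting beliefs when the data have nonempty intersection; with only ∅ not believed, the agent believing all nonempty sets solves every problem, and the claim fails for S=ℕ∪{∞}, O={{n,n+1,…,∞}}, Q={ℕ,{∞}}. *)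

theory Defs
  imports "HOL-Library.Disjoint_Sets" "HOL-Library.Countable_Set"
begin

type_synonym 'a space = "'a set \<times> 'a set set"

definition epistemic_space :: "'a space \<Rightarrow> bool" where
  "epistemic_space SS \<longleftrightarrow> (case SS of (S, Obs) \<Rightarrow> Obs \<subseteq> Pow S \<and> countable Obs)"

definition data_sequence :: "'a space \<Rightarrow> 'a set list \<Rightarrow> bool" where
  "data_sequence SS \<sigma> \<longleftrightarrow> \<sigma> \<noteq> [] \<and> set \<sigma> \<subseteq> snd SS"

definition data_stream :: "'a space \<Rightarrow> (nat \<Rightarrow> 'a set) \<Rightarrow> bool" where
  "data_stream SS Os \<longleftrightarrow> range Os \<subseteq> snd SS"

definition data_stream_for :: "'a space \<Rightarrow> 'a \<Rightarrow> (nat \<Rightarrow> 'a set) \<Rightarrow> bool" where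
  "data_stream_for SS s Os \<longleftrightarrow>
     data_stream SS Os \<and>
     {U \<in> snd SS. s \<in> U} = {U \<in> snd SS. \<exists>n. (\<Inter>i\<le>n. Os i) \<subseteq> U}"

definition initial_segment :: "(nat \<Rightarrow> 'a set) \<Rightarrow> nat \<Rightarrow> 'a set list" where
  "initial_segment Os n = map Os [0..<n]"

definition inductive_problem :: "'a space \<Rightarrow> 'a set set \<Rightarrow> bool" where
  "inductive_problem SS Q \<longleftrightarrow> epistemic_space SS \<and> partition_on (fst SS) Q"

definition answer :: "'a set set \<Rightarrow> 'a \<Rightarrow> 'a set" where
  "answer Q s = (THE A. A \<in> Q \<and> s \<in> A)"

type_synonym 'a learner = "'a space \<Rightarrow> 'a set list \<Rightarrow> 'a set set"

text \<open>
  Consistency of beliefs is required of the beliefs taken together: on data with nonempty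
  intersection an agent believes neither the empty proposition nor two mutually contradictory
  propositions. Excluding only the empty proposition would admit the agent that believes
  every nonempty subset of \<open>S\<close>; that agent solves every problem, including ones that no agent
  induced by a total preorder solves. Any belief family that is closed under binary
  intersection and omits the empty set satisfies the second condition.
\<close>

definition agent :: "'a learner \<Rightarrow> bool" where
  "agent L \<longleftrightarrow>
     (\<forall>SS \<sigma>. epistemic_space SS \<longrightarrow> data_sequence SS \<sigma> \<longrightarrow>
        L SS \<sigma> \<subseteq> Pow (fst SS) \<and>
        (\<Inter>(set \<sigma>) \<noteq> {} \<longrightarrow>
           {} \<notin> L SS \<sigma> \<and> (\<forall>P\<in>L SS \<sigma>. \<forall>R\<in>L SS \<sigma>. P \<inter> R \<noteq> {})))"

text \<open>
  The empty initial segment (\<open>n = 0\<close>) is not a data sequence; it is harmless here, since the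
  threshold \<open>k\<close> may always be enlarged.
\<close>

definition solves :: "'a learner \<Rightarrow> 'a space \<Rightarrow> 'a set set \<Rightarrow> bool" where
  "solves L SS Q \<longleftrightarrow>
     (\<forall>s\<in>fst SS. \<forall>Os. data_stream_for SS s Os \<longrightarrow>
        (\<exists>k. \<forall>n\<ge>k. answer Q s \<in> L SS (initial_segment Os n)))"

definition solvable :: "'a space \<Rightarrow> 'a set set \<Rightarrow> bool" where
  "solvable SS Q \<longleftrightarrow> (\<exists>L. agent L \<and> solves L SS Q)"

definition agm_beliefs :: "'a set \<Rightarrow> 'a rel \<Rightarrow> 'a set list \<Rightarrow> 'a set set" where
  "agm_beliefs S r \<sigma> =
     {P. P \<subseteq> S \<and> (\<exists>s\<in>\<Inter>(set \<sigma>). \<forall>t\<in>\<Inter>(set \<sigma>). (t, s) \<in> r \<longrightarrow> t \<in> P)}"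

definition agm_agent :: "('a space \<Rightarrow> 'a rel) \<Rightarrow> 'a learner \<Rightarrow> bool" where
  "agm_agent le L \<longleftrightarrow>
     agent L \<and>
     (\<forall>SS. epistemic_space SS \<longrightarrow>
        preorder_on (fst SS) (le SS) \<and> total_on (fst SS) (le SS) \<and>
        (\<forall>\<sigma>. data_sequence SS \<sigma> \<longrightarrow> L SS \<sigma> = agm_beliefs (fst SS) (le SS) \<sigma>))"

end

theory Submission
  imports Defs
begin

text \<open>
  Take the topology on \<open>S\<close> generated by the observable properties. A solving agent has a
  locking sequence \<open>\<sigma>\<close> for every state \<open>s\<close>: data true at \<open>s\<close> such that no further data true at \<open>s\<close>
  dislodge the answer \<open>A\<^sub>s\<close>. The states locked by \<open>\<sigma>\<close> are \<open>U - V\<close>, where \<open>U\<close> is the intersection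
  of \<open>\<sigma>\<close> and \<open>V\<close> is the open set of states in \<open>U\<close> at which some true extension of \<open>\<sigma>\<close> changes
  the believed answer; all of them lie in the same answer. There are countably many \<open>\<sigma>\<close>; enumerate
  all these open sets \<open>U\<close> and \<open>V\<close> as \<open>W\<^sub>0, W\<^sub>1, \<dots>\<close> and order the states lexicographically by their
  membership sequences, with nonmembership first. If \<open>s\<close> is locked by \<open>\<sigma>\<close>, let \<open>N\<close> bound the
  indices of the two sets belonging to \<open>\<sigma>\<close>. On the neighbourhood of \<open>s\<close> formed by the \<open>W\<^sub>j\<close>
  containing \<open>s\<close> with \<open>j \<le> N\<close>, any \<open>t \<le> s\<close> agrees with \<open>s\<close> up to \<open>N\<close>, so \<open>t\<close> is locked
  by \<open>\<sigma>\<close> as well and lies in \<open>A\<^sub>s\<close>.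
\<close>

section \<open>The lexicographic preorder of membership sequences\<close>

definition lex_membership :: "'a set \<Rightarrow> (nat \<Rightarrow> 'a set) \<Rightarrow> 'a rel" where
  "lex_membership S W = {(t, s). t \<in> S \<and> s \<in> S \<and>
     ((\<forall>j. t \<in> W j \<longleftrightarrow> s \<in> W j) \<or>
      (\<exists>n. (\<forall>j<n. t \<in> W j \<longleftrightarrow> s \<in> W j) \<and> t \<notin> W n \<and> s \<in> W n))}"

lemma trans_lex_membership: "trans (lex_membership S W)"
proof (rule transI)
  fix x y z
  assume xy: "(x, y) \<in> lex_membership S W" and yz: "(y, z) \<in> lex_membership S W"
  then have S: "x \<in> S" "z \<in> S" by (auto simp: lex_membership_def)
  consider "\<forall>j. x \<in> W j \<longleftrightarrow> y \<in> W j" | "\<forall>j. y \<in> W j \<longleftrightarrow> z \<in> W j"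
    | m n where "\<forall>j<m. x \<in> W j \<longleftrightarrow> y \<in> W j" "x \<notin> W m" "y \<in> W m"
        "\<forall>j<n. y \<in> W j \<longleftrightarrow> z \<in> W j" "y \<notin> W n" "z \<in> W n"
    using xy yz by (auto simp: lex_membership_def)
  then show "(x, z) \<in> lex_membership S W"
  proof cases
    case 3
    \<comment> \<open>The two first differences cannot coincide, since \<open>y\<close> is in
      \<open>W m\<close> but not in \<open>W n\<close>. The earlier one is the first difference of
      \<open>x\<close> and \<open>z\<close>.\<close>
    then have "(\<forall>j<min m n. x \<in> W j \<longleftrightarrow> z \<in> W j) \<and> x \<notin> W (min m n) \<and> z \<in> W (min m n)"
      by (cases m n rule: linorder_cases) (auto simp: min_def)
    then show ?thesis using S unfolding lex_membership_def by blast
  qed (use S xy yz in \<open>auto simp: lex_membership_def\<close>)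
qed

lemma preorder_on_lex_membership: "preorder_on S (lex_membership S W)"
  unfolding preorder_on_def
  using trans_lex_membership by (auto simp: refl_on_def lex_membership_def)

lemma total_on_lex_membership: "total_on S (lex_membership S W)"
proof (rule total_onI)
  fix x y assume S: "x \<in> S" "y \<in> S"
  show "(x, y) \<in> lex_membership S W \<or> (y, x) \<in> lex_membership S W"
  proof (cases "\<forall>j. x \<in> W j \<longleftrightarrow> y \<in> W j")
    case True
    then show ?thesis using S by (auto simp: lex_membership_def)
  next
    case False
    define n where "n = (LEAST j. (x \<in> W j) \<noteq> (y \<in> W j))"
    have n: "(x \<in> W n) \<noteq> (y \<in> W n)"
      unfolding n_def by (rule LeastI_ex[of "\<lambda>j. (x \<in> W j) \<noteq> (y \<in> W j)"]) (use False in simp)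
    have "\<forall>j<n. x \<in> W j \<longleftrightarrow> y \<in> W j"
      unfolding n_def using not_less_Least by blast
    then show ?thesis using S n by (auto simp: lex_membership_def)
  qed
qed

text \<open>If \<open>t\<close> is strictly below \<open>s\<close>, the first difference is a set
  that contains \<open>s\<close> and omits \<open>t\<close>. The second assumption pushes that index
  beyond \<open>N\<close>.\<close>

lemma lex_membership_agree:
  assumes "(t, s) \<in> lex_membership S W" "\<forall>j\<le>N. s \<in> W j \<longrightarrow> t \<in> W j" "j \<le> N"
  shows "t \<in> W j \<longleftrightarrow> s \<in> W j"
proof -
  have "\<not> n \<le> N" if "t \<notin> W n" "s \<in> W n" for n
    using assms(2) that by blast
  then consider "\<forall>j. t \<in> W j \<longleftrightarrow> s \<in> W j" | n where "N < n" "\<forall>j<n. t \<in> W j \<longleftrightarrow> s \<in> W j"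
    using assms(1) unfolding lex_membership_def by (auto simp: not_le)
  then show ?thesis using assms(3) by cases auto
qed

text \<open>Totality makes the beliefs jointly consistent: of the witnesses for two beliefs, the
  lower one lies in both propositions.\<close>

lemma agm_agentI:
  assumes "\<And>SS. epistemic_space SS \<Longrightarrow> preorder_on (fst SS) (le SS) \<and> total_on (fst SS) (le SS)"
  shows "agm_agent le (\<lambda>SS. agm_beliefs (fst SS) (le SS))"
proof -
  have "P \<inter> R \<noteq> {}"
    if SS: "epistemic_space SS" "data_sequence SS \<sigma>"
      and PR: "P \<in> agm_beliefs (fst SS) (le SS) \<sigma>" "R \<in> agm_beliefs (fst SS) (le SS) \<sigma>"
    for SS \<sigma> P R
  proof -
    \<comment> \<open>A data sequence is nonempty, so its intersection is not \<open>UNIV\<close> by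
      convention.\<close>
    have sub: "\<Inter>(set \<sigma>) \<subseteq> fst SS"
      using SS by (cases \<sigma>) (auto simp: data_sequence_def epistemic_space_def subset_iff)
    obtain p where p: "p \<in> \<Inter>(set \<sigma>)" "\<forall>t\<in>\<Inter>(set \<sigma>). (t, p) \<in> le SS \<longrightarrow> t \<in> P"
      using PR by (auto simp: agm_beliefs_def)
    obtain r where r: "r \<in> \<Inter>(set \<sigma>)" "\<forall>t\<in>\<Inter>(set \<sigma>). (t, r) \<in> le SS \<longrightarrow> t \<in> R"
      using PR by (auto simp: agm_beliefs_def)
    have S: "p \<in> fst SS" "r \<in> fst SS" using sub p r by blast+
    have refl: "refl_on (fst SS) (le SS)" and tot: "total_on (fst SS) (le SS)"
      using assms[OF SS(1)] by (auto simp: preorder_on_def)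
    have "(p, p) \<in> le SS" "(r, r) \<in> le SS"
      using refl S by (auto simp: refl_on_def)
    moreover have "(p, r) \<in> le SS \<or> (r, p) \<in> le SS"
      using tot S calculation by (cases "p = r") (auto simp: total_on_def)
    ultimately show ?thesis using p r by blast
  qed
  \<comment> \<open>Taking \<open>R\<close> equal to \<open>P\<close> rules out the empty
    proposition.\<close>
  then have "agent (\<lambda>SS. agm_beliefs (fst SS) (le SS))"
    unfolding agent_def by (metis (no_types, lifting) Int_absorb Pow_iff agm_beliefs_def mem_Collect_eq subsetI)
  then show ?thesis using assms by (auto simp: agm_agent_def)
qed

section \<open>Answers and data streams\<close>

lemma partition_on_answer:
  assumes "partition_on S Q" "s \<in> S"
  shows "answer Q s \<in> Q" "s \<in> answer Q s"
proof -
  obtain A where A: "A \<in> Q" "s \<in> A"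
    using assms by (auto simp: partition_on_def)
  have "B = A" if "B \<in> Q" "s \<in> B" for B
    using disjointD[OF partition_onD2[OF assms(1)], of B A] A that by blast
  with A have "\<exists>!A. A \<in> Q \<and> s \<in> A" by blast
  from theI'[OF this] show "answer Q s \<in> Q" "s \<in> answer Q s"
    by (auto simp: answer_def)
qed

text \<open>This is convergence of the stream to \<open>s\<close>: each observable true at
  \<open>s\<close> is entailed from some time on, and \<open>\<tau>\<close> has only finitely many
  entries.\<close>

lemma data_stream_for_eventually_subset:
  assumes "data_stream_for SS s Os" "set \<tau> \<subseteq> snd SS" "s \<in> \<Inter>(set \<tau>)"
  shows "\<forall>\<^sub>F n in sequentially. \<Inter>(set (initial_segment Os n)) \<subseteq> \<Inter>(set \<tau>)"
proof -
  have "\<forall>\<^sub>F n in sequentially. \<Inter>(set (initial_segment Os n)) \<subseteq> U" if "U \<in> set \<tau>" for U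
  proof -
    have "U \<in> {U \<in> snd SS. s \<in> U}" using assms that by auto
    then have "U \<in> {U \<in> snd SS. \<exists>n. (\<Inter>i\<le>n. Os i) \<subseteq> U}"
      using assms(1) unfolding data_stream_for_def by blast
    then obtain m where m: "(\<Inter>i\<le>m. Os i) \<subseteq> U" by auto
    have "\<Inter>(set (initial_segment Os n)) \<subseteq> U" if "n \<ge> Suc m" for n
      using m that by (force simp: initial_segment_def)
    then show ?thesis unfolding eventually_sequentially by blast
  qed
  then have "\<forall>\<^sub>F n in sequentially. \<forall>U\<in>set \<tau>. \<Inter>(set (initial_segment Os n)) \<subseteq> U"
    by (simp add: eventually_ball_finite)
  then show ?thesis by (rule eventually_mono) blast
qed

lemma data_stream_for_mem:
  assumes "data_stream_for SS s Os"
  shows "Os i \<in> snd SS" "s \<in> Os i"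
proof -
  show *: "Os i \<in> snd SS"
    using assms by (auto simp: data_stream_for_def data_stream_def)
  have "(\<Inter>j\<le>i. Os j) \<subseteq> Os i" by auto
  then have "Os i \<in> {U \<in> snd SS. \<exists>n. (\<Inter>i\<le>n. Os i) \<subseteq> U}" using * by blast
  then show "s \<in> Os i" using assms unfolding data_stream_for_def by blast
qed

lemma data_stream_forI:
  assumes "range Os = {U \<in> snd SS. s \<in> U}"
  shows "data_stream_for SS s Os"
proof -
  have s: "s \<in> Os i" "Os i \<in> snd SS" for i using assms by blast+
  have "\<exists>n. (\<Inter>i\<le>n. Os i) \<subseteq> U" if "U \<in> snd SS" "s \<in> U" for U
  proof -
    have "U \<in> range Os" using assms that by simp
    then obtain n where "U = Os n" by (rule rangeE)
    then show ?thesis by (intro exI[of _ n]) auto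
  qed
  then show ?thesis
    using s by (auto simp: data_stream_for_def data_stream_def)
qed

lemma countable_true_observations:
  assumes "epistemic_space SS"
  shows "countable {U \<in> snd SS. s \<in> U}"
  using assms by (auto simp: epistemic_space_def intro: countable_subset split: prod.splits)

section \<open>Existence of locking sequences\<close>

lemma chain_of_lists_limit:
  fixes \<rho> :: "nat \<Rightarrow> 'b list"
  assumes ext: "\<And>n. \<exists>xs. \<rho> (Suc n) = \<rho> n @ xs" and len: "\<And>n. n < length (\<rho> n)"
  obtains f where "\<And>n. \<rho> n = map f [0..<length (\<rho> n)]"
proof -
  have mono: "i < length (\<rho> m) \<Longrightarrow> i < length (\<rho> n) \<and> \<rho> n ! i = \<rho> m ! i" if "m \<le> n" for i m n
    using that
  proof (induction n rule: dec_induct)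
    case (step n)
    then show ?case using ext[of n] by (auto simp: nth_append)
  qed simp
  \<comment> \<open>By \<open>len\<close>, index \<open>i\<close> lies inside
    \<open>\<rho> i\<close>. Lists of the chain agree wherever both are defined, so the diagonal
    extends all of them.\<close>
  define f where "f i = \<rho> i ! i" for i
  have "\<rho> n = map f [0..<length (\<rho> n)]" for n
  proof (rule nth_equalityI)
    fix i assume i: "i < length (\<rho> n)"
    then have "\<rho> n ! i = \<rho> i ! i"
      using mono[of i n i] mono[of n i i] len[of i] by (cases "i \<le> n") auto
    then show "\<rho> n ! i = map f [0..<length (\<rho> n)] ! i" using i by (simp add: f_def)
  qed simp
  then show thesis using that by blast
qed

text \<open>Otherwise every nonempty list of data true at \<open>s\<close> extends to one that
  dislodges the answer. Repeating this while interleaving all true observables gives a data stream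
  for \<open>s\<close> on which the agent fails to converge. \<open>U0\<close> supplies a first
  entry.\<close>

lemma locking_sequence_exists:
  assumes SS: "epistemic_space SS" and L: "solves L SS Q"
    and s: "s \<in> fst SS" and U0: "U0 \<in> snd SS" "s \<in> U0"
  obtains \<sigma> where "data_sequence SS \<sigma>" "s \<in> \<Inter>(set \<sigma>)"
    "\<And>\<tau>. set \<tau> \<subseteq> {U \<in> snd SS. s \<in> U} \<Longrightarrow> answer Q s \<in> L SS (\<sigma> @ \<tau>)"
proof (rule ccontr)
  assume not_thesis: "\<not> thesis"
  note locking = that
  define Os where "Os = {U \<in> snd SS. s \<in> U}"
  have "\<exists>\<tau>. set \<tau> \<subseteq> Os \<and> answer Q s \<notin> L SS (\<sigma> @ \<tau>)" if "\<sigma> \<noteq> []" "set \<sigma> \<subseteq> Os" for \<sigma>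
  proof -
    have "data_sequence SS \<sigma>" "s \<in> \<Inter>(set \<sigma>)"
      using that by (auto simp: data_sequence_def Os_def)
    then show ?thesis using not_thesis locking[of \<sigma>] unfolding Os_def by blast
  qed
  then obtain ext where ext: "\<And>\<sigma>. \<sigma> \<noteq> [] \<Longrightarrow> set \<sigma> \<subseteq> Os \<Longrightarrow>
      set (ext \<sigma>) \<subseteq> Os \<and> answer Q s \<notin> L SS (\<sigma> @ ext \<sigma>)" by metis
  have "Os \<noteq> {}" using U0 by (auto simp: Os_def)
  then obtain e :: "nat \<Rightarrow> _" where e: "range e = Os"
    using range_from_nat_into countable_true_observations[OF SS, of s] unfolding Os_def by metis
  \<comment> \<open>\<open>ext\<close> dislodges the answer; the appended \<open>e n\<close> ensures
    that every true observable occurs and that the lengths grow.\<close>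
  define \<rho> where "\<rho> = rec_nat [e 0] (\<lambda>n \<sigma>. \<sigma> @ ext \<sigma> @ [e n])"
  have \<rho>: "\<rho> 0 = [e 0]" "\<And>n. \<rho> (Suc n) = \<rho> n @ ext (\<rho> n) @ [e n]"
    by (simp_all add: \<rho>_def)
  have len: "n < length (\<rho> n)" for n by (induction n) (auto simp: \<rho>)
  have ne: "\<rho> n \<noteq> []" for n using len[of n] by auto
  have \<rho>_Os: "set (\<rho> n) \<subseteq> Os" for n
  proof (induction n)
    case 0
    then show ?case using e by (auto simp: \<rho>)
  next
    case (Suc n)
    then show ?case using e ext[OF ne Suc] by (auto simp: \<rho>)
  qed
  obtain f where f: "\<And>n. \<rho> n = map f [0..<length (\<rho> n)]"
    using chain_of_lists_limit[of \<rho>] \<rho>(2) len by metis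
  have f_mem: "f i \<in> set (\<rho> i)" for i
    using f[of i] len[of i] by (metis atLeastLessThan_iff image_eqI le0 list.set_map set_upt)
  have "e n \<in> range f" for n
  proof -
    have "e n \<in> set (\<rho> (Suc n))" by (simp add: \<rho>)
    then show ?thesis by (subst (asm) f) auto
  qed
  then have "range f = Os" using e \<rho>_Os f_mem by blast
  then have "data_stream_for SS s f" unfolding Os_def by (rule data_stream_forI)
  then obtain k where k: "\<And>n. n \<ge> k \<Longrightarrow> answer Q s \<in> L SS (initial_segment f n)"
    using L s unfolding solves_def by blast
  \<comment> \<open>The failure occurs one entry before the end of \<open>\<rho> (Suc k)\<close>,
    just before \<open>e k\<close> is appended.\<close>
  define n where "n = length (\<rho> k @ ext (\<rho> k))"
  have "\<rho> (Suc k) = initial_segment f n @ [f n]"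
    by (subst f) (simp add: \<rho>(2) n_def initial_segment_def)
  then have "initial_segment f n = \<rho> k @ ext (\<rho> k)"
    by (simp add: \<rho>(2) flip: append_assoc)
  moreover have "n \<ge> k" using len[of k] by (simp add: n_def)
  ultimately show False using k ext[OF ne \<rho>_Os, of k] by metis
qed

section \<open>Open sets and locked states\<close>

definition observable_open :: "'a space \<Rightarrow> 'a set \<Rightarrow> bool" where
  "observable_open SS W \<longleftrightarrow>
     (\<forall>s\<in>W. \<exists>\<tau>. set \<tau> \<subseteq> snd SS \<and> s \<in> \<Inter>(set \<tau>) \<and> \<Inter>(set \<tau>) \<subseteq> W)"

text \<open>Comparing the believed cells of \<open>Q\<close>, instead of testing for the answer at
  one state, makes the set depend on \<open>\<sigma>\<close> alone, so countably many such sets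
  suffice.\<close>

definition unlocked :: "'a learner \<Rightarrow> 'a space \<Rightarrow> 'a set set \<Rightarrow> 'a set list \<Rightarrow> 'a set" where
  "unlocked L SS Q \<sigma> = {t \<in> \<Inter>(set \<sigma>). \<exists>\<tau>. set \<tau> \<subseteq> snd SS \<and> t \<in> \<Inter>(set \<tau>) \<and>
     L SS (\<sigma> @ \<tau>) \<inter> Q \<noteq> L SS \<sigma> \<inter> Q}"

lemma observable_open_Inter:
  "set \<sigma> \<subseteq> snd SS \<Longrightarrow> observable_open SS (\<Inter>(set \<sigma>))"
  by (auto simp: observable_open_def)

text \<open>A list \<open>\<tau>\<close> that changes the believed answers at \<open>t\<close> does
  so at every state where \<open>\<sigma> @ \<tau>\<close> is true.\<close>

lemma observable_open_unlocked:
  assumes "set \<sigma> \<subseteq> snd SS"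
  shows "observable_open SS (unlocked L SS Q \<sigma>)"
  unfolding observable_open_def
proof
  fix t assume "t \<in> unlocked L SS Q \<sigma>"
  then obtain \<tau> where "t \<in> \<Inter>(set \<sigma>)" "set \<tau> \<subseteq> snd SS" "t \<in> \<Inter>(set \<tau>)"
    "L SS (\<sigma> @ \<tau>) \<inter> Q \<noteq> L SS \<sigma> \<inter> Q" by (auto simp: unlocked_def)
  then show "\<exists>\<tau>. set \<tau> \<subseteq> snd SS \<and> t \<in> \<Inter>(set \<tau>) \<and> \<Inter>(set \<tau>) \<subseteq> unlocked L SS Q \<sigma>"
    using assms by (intro exI[of _ "\<sigma> @ \<tau>"]) (auto simp: unlocked_def)
qed

text \<open>Joint consistency of beliefs enters here: distinct cells are disjoint.\<close>

lemma agent_believes_one_answer: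
  assumes "agent L" "epistemic_space SS" "partition_on (fst SS) Q" "data_sequence SS \<sigma>"
    "\<Inter>(set \<sigma>) \<noteq> {}" "A \<in> Q" "A \<in> L SS \<sigma>"
  shows "L SS \<sigma> \<inter> Q = {A}"
proof -
  have "B = A" if "B \<in> L SS \<sigma>" "B \<in> Q" for B
    using that assms disjointD[OF partition_onD2[OF assms(3)], of A B]
    unfolding agent_def by blast
  then show ?thesis using assms by blast
qed

text \<open>Continue \<open>\<sigma>\<close> by an enumeration of the observables true at
  \<open>t\<close>. The agent must come to believe the answer at \<open>t\<close>, yet its believed
  answers stay those at \<open>\<sigma>\<close>, namely \<open>A\<close> alone.\<close>

lemma not_unlocked_same_answer:
  assumes L: "agent L" "solves L SS Q" and P: "epistemic_space SS" "partition_on (fst SS) Q"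
    and \<sigma>: "data_sequence SS \<sigma>" and A: "L SS \<sigma> \<inter> Q = {A}"
    and t: "t \<in> fst SS" "t \<in> \<Inter>(set \<sigma>)" "t \<notin> unlocked L SS Q \<sigma>"
  shows "t \<in> A"
proof -
  let ?O = "{U \<in> snd SS. t \<in> U}"
  have \<sigma>O: "set \<sigma> \<subseteq> ?O" "\<sigma> \<noteq> []" using \<sigma> t by (auto simp: data_sequence_def)
  then have "?O \<noteq> {}" by (metis set_empty subset_empty)
  then obtain e :: "nat \<Rightarrow> _" where e: "range e = ?O"
    using range_from_nat_into countable_true_observations[OF P(1), of t] by metis
  define f where "f i = (if i < length \<sigma> then \<sigma> ! i else e (i - length \<sigma>))" for i
  have seg: "initial_segment f (length \<sigma> + k) = \<sigma> @ map e [0..<k]" for k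
    by (rule nth_equalityI) (auto simp: initial_segment_def f_def nth_append)
  have "e k \<in> range f" for k
    using image_eqI[of "e k" f "k + length \<sigma>" UNIV] by (simp add: f_def)
  moreover have "f i \<in> ?O" for i
  proof (cases "i < length \<sigma>")
    case True
    then show ?thesis using \<sigma>O(1) nth_mem[OF True] by (auto simp: f_def simp del: nth_mem)
  next
    case False
    then show ?thesis using e unfolding f_def by auto
  qed
  ultimately have "range e \<subseteq> range f" "range f \<subseteq> ?O" by (simp_all add: image_subset_iff)
  then have "range f = ?O" unfolding e by (rule equalityI[rotated])
  then have "data_stream_for SS t f" by (rule data_stream_forI)
  then obtain k where "\<And>n. n \<ge> k \<Longrightarrow> answer Q t \<in> L SS (initial_segment f n)"
    using L t(1) unfolding solves_def by blast
  then have "answer Q t \<in> L SS (\<sigma> @ map e [0..<k])"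
    by (metis le_add2 seg)
  moreover have "set (map e [0..<k]) \<subseteq> ?O" using e by auto
  then have "L SS (\<sigma> @ map e [0..<k]) \<inter> Q = L SS \<sigma> \<inter> Q"
    using t unfolding unlocked_def by blast
  ultimately have "answer Q t = A" using A partition_on_answer(1)[OF P(2) t(1)] by blast
  then show ?thesis using partition_on_answer(2)[OF P(2) t(1)] by simp
qed

text \<open>Near each state that has a true observable, finitely many membership bits determine the
  answer. Such an observable is needed to start a locking sequence.\<close>

lemma solvable_separating_sequence:
  assumes "inductive_problem SS Q" "solvable SS Q"
  obtains W :: "nat \<Rightarrow> 'a set" where "\<And>j. observable_open SS (W j)"
    "\<And>s U. s \<in> fst SS \<Longrightarrow> U \<in> snd SS \<Longrightarrow> s \<in> U \<Longrightarrow>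
       \<exists>N. \<forall>t\<in>fst SS. (\<forall>j\<le>N. t \<in> W j \<longleftrightarrow> s \<in> W j) \<longrightarrow> t \<in> answer Q s"
proof -
  have P: "epistemic_space SS" "partition_on (fst SS) Q"
    using assms(1) by (auto simp: inductive_problem_def)
  obtain L where L: "agent L" "solves L SS Q" using assms(2) by (auto simp: solvable_def)
  define \<W> where "\<W> = insert {} ((\<lambda>\<sigma>. \<Inter>(set \<sigma>)) ` lists (snd SS) \<union> unlocked L SS Q ` lists (snd SS))"
  have "countable (snd SS)" using P(1) by (auto simp: epistemic_space_def)
  then have "countable \<W>" "\<W> \<noteq> {}" unfolding \<W>_def by auto
  then obtain W :: "nat \<Rightarrow> 'a set" where W: "range W = \<W>"
    using range_from_nat_into by metis
  show thesis
  proof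
    fix j
    have "W j \<in> \<W>" using W by blast
    then show "observable_open SS (W j)"
      unfolding \<W>_def
      by (auto intro: observable_open_unlocked observable_open_Inter simp: lists_eq_set)
        (simp add: observable_open_def)
  next
    fix s U assume s: "s \<in> fst SS" "U \<in> snd SS" "s \<in> U"
    obtain \<sigma> where \<sigma>: "data_sequence SS \<sigma>" "s \<in> \<Inter>(set \<sigma>)"
      and lock: "\<And>\<tau>. set \<tau> \<subseteq> {U \<in> snd SS. s \<in> U} \<Longrightarrow> answer Q s \<in> L SS (\<sigma> @ \<tau>)"
      using locking_sequence_exists[OF P(1) L(2) s] by blast
    have one: "L SS (\<sigma> @ \<tau>) \<inter> Q = {answer Q s}" if "set \<tau> \<subseteq> snd SS" "s \<in> \<Inter>(set \<tau>)" for \<tau>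
    proof (rule agent_believes_one_answer[OF L(1) P])
      show "data_sequence SS (\<sigma> @ \<tau>)" using \<sigma> that by (auto simp: data_sequence_def)
      show "\<Inter>(set (\<sigma> @ \<tau>)) \<noteq> {}" using \<sigma>(2) that by auto
      show "answer Q s \<in> L SS (\<sigma> @ \<tau>)" using that by (intro lock) auto
    qed (rule partition_on_answer(1)[OF P(2) s(1)])
    have one_nil: "L SS \<sigma> \<inter> Q = {answer Q s}" using one[of "[]"] by simp
    have s_notin: "s \<notin> unlocked L SS Q \<sigma>"
    proof
      assume "s \<in> unlocked L SS Q \<sigma>"
      then obtain \<tau> where \<tau>: "set \<tau> \<subseteq> snd SS" "s \<in> \<Inter>(set \<tau>)"
        and "L SS (\<sigma> @ \<tau>) \<inter> Q \<noteq> L SS \<sigma> \<inter> Q"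
        unfolding unlocked_def mem_Collect_eq by metis
      then show False using one[OF \<tau>] one_nil by simp
    qed
    have "\<sigma> \<in> lists (snd SS)" using \<sigma>(1) by (auto simp: data_sequence_def)
    then have "\<Inter>(set \<sigma>) \<in> range W" "unlocked L SS Q \<sigma> \<in> range W"
      unfolding W \<W>_def by blast+
    then obtain m n where mn: "W m = \<Inter>(set \<sigma>)" "W n = unlocked L SS Q \<sigma>" by (metis rangeE)
    \<comment> \<open>The bound is \<open>max m n\<close>: agreement up to it makes \<open>t\<close>
      locked by \<open>\<sigma>\<close> too.\<close>
    show "\<exists>N. \<forall>t\<in>fst SS. (\<forall>j\<le>N. t \<in> W j \<longleftrightarrow> s \<in> W j) \<longrightarrow> t \<in> answer Q s"
    proof (intro exI ballI impI)
      fix t assume t: "t \<in> fst SS" "\<forall>j\<le>max m n. t \<in> W j \<longleftrightarrow> s \<in> W j"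
      then have "t \<in> W m \<longleftrightarrow> s \<in> W m" "t \<in> W n \<longleftrightarrow> s \<in> W n" by simp_all
      then have "t \<in> \<Inter>(set \<sigma>)" "t \<notin> unlocked L SS Q \<sigma>"
        using \<sigma>(2) s_notin unfolding mn by blast+
      then show "t \<in> answer Q s"
        by (rule not_unlocked_same_answer[OF L P \<sigma>(1) one_nil t(1)])
    qed
  qed
qed

section \<open>Convergence of the lexicographic agent\<close>

lemma lex_membership_solves:
  assumes P: "inductive_problem SS Q"
    and W_open: "\<And>j. observable_open SS (W j)"
    and W_sep: "\<And>s U. s \<in> fst SS \<Longrightarrow> U \<in> snd SS \<Longrightarrow> s \<in> U \<Longrightarrow>
       \<exists>N. \<forall>t\<in>fst SS. (\<forall>j\<le>N. t \<in> W j \<longleftrightarrow> s \<in> W j) \<longrightarrow> t \<in> answer Q s"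
    and le: "le SS = lex_membership (fst SS) W"
  shows "solves (\<lambda>SS. agm_beliefs (fst SS) (le SS)) SS Q"
  unfolding solves_def
proof (intro ballI allI impI)
  fix s Os assume s: "s \<in> fst SS" and Os: "data_stream_for SS s Os"
  obtain N where N: "\<And>t. t \<in> fst SS \<Longrightarrow> \<forall>j\<le>N. t \<in> W j \<longleftrightarrow> s \<in> W j \<Longrightarrow> t \<in> answer Q s"
    \<comment> \<open>The first entry of the stream serves as the observable true at
      \<open>s\<close>.\<close>
    using W_sep[OF s data_stream_for_mem[OF Os, of 0]] by blast
  have "\<forall>\<^sub>F n in sequentially. \<Inter>(set (initial_segment Os n)) \<subseteq> W j" if sj: "s \<in> W j" for j
  proof -
    obtain \<tau> where \<tau>: "set \<tau> \<subseteq> snd SS" "s \<in> \<Inter>(set \<tau>)" "\<Inter>(set \<tau>) \<subseteq> W j"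
      using W_open[of j] sj unfolding observable_open_def by meson
    show ?thesis
      using data_stream_for_eventually_subset[OF Os \<tau>(1,2)] by (rule eventually_mono) (use \<tau>(3) in blast)
  qed
  \<comment> \<open>Only finitely many sets must be entailed, so one threshold serves them
    all.\<close>
  then have "\<forall>\<^sub>F n in sequentially. \<forall>j\<in>{j. j \<le> N \<and> s \<in> W j}. \<Inter>(set (initial_segment Os n)) \<subseteq> W j"
    by (intro eventually_ball_finite) auto
  then obtain k where k: "\<And>n j. n \<ge> k \<Longrightarrow> j \<le> N \<Longrightarrow> s \<in> W j \<Longrightarrow> \<Inter>(set (initial_segment Os n)) \<subseteq> W j"
    unfolding eventually_sequentially by blast
  have part: "partition_on (fst SS) Q" using P by (simp add: inductive_problem_def)
  show "\<exists>k. \<forall>n\<ge>k. answer Q s \<in> agm_beliefs (fst SS) (le SS) (initial_segment Os n)"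
  proof (intro exI allI impI)
    fix n assume n: "n \<ge> k"
    \<comment> \<open>The state \<open>s\<close> itself witnesses the belief; no minimal state has
      to exist.\<close>
    have "t \<in> answer Q s"
      if "t \<in> \<Inter>(set (initial_segment Os n))" "(t, s) \<in> le SS" for t
    proof (rule N)
      show "t \<in> fst SS" using that(2) by (auto simp: le lex_membership_def)
      show "\<forall>j\<le>N. t \<in> W j \<longleftrightarrow> s \<in> W j"
        using lex_membership_agree[of t s "fst SS" W N] that k[OF n] unfolding le by blast
    qed
    moreover have "s \<in> \<Inter>(set (initial_segment Os n))"
      using data_stream_for_mem(2)[OF Os] by (auto simp: initial_segment_def)
    moreover have "answer Q s \<subseteq> fst SS"
      using partition_on_answer(1)[OF part s] partition_onD1[OF part] by blast
    ultimately show "answer Q s \<in> agm_beliefs (fst SS) (le SS) (initial_segment Os n)"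
      unfolding agm_beliefs_def by blast
  qed
qed

theorem theorem3:
  fixes SS :: "'a space" and Q :: "'a set set"
  assumes "inductive_problem SS Q"
    and "solvable SS Q"
  shows "\<exists>le L. agm_agent le L \<and> solves L SS Q"
proof -
  obtain W :: "nat \<Rightarrow> 'a set" where W: "\<And>j. observable_open SS (W j)"
    "\<And>s U. s \<in> fst SS \<Longrightarrow> U \<in> snd SS \<Longrightarrow> s \<in> U \<Longrightarrow>
       \<exists>N. \<forall>t\<in>fst SS. (\<forall>j\<le>N. t \<in> W j \<longleftrightarrow> s \<in> W j) \<longrightarrow> t \<in> answer Q s"
    using solvable_separating_sequence[OF assms] by blast
  \<comment> \<open>An agent needs a total preorder on every space. Any sequence of sets induces one
    on any carrier, so the \<open>W\<close> found for \<open>SS\<close> is used throughout.\<close>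
  define le where "le T = lex_membership (fst T) W" for T :: "'a space"
  have "agm_agent le (\<lambda>SS. agm_beliefs (fst SS) (le SS))"
    by (rule agm_agentI)
      (simp add: le_def preorder_on_lex_membership total_on_lex_membership)
  moreover have "solves (\<lambda>SS. agm_beliefs (fst SS) (le SS)) SS Q"
    by (rule lex_membership_solves[where W = W and le = le, OF assms(1) W le_def[of SS]])
  ultimately show ?thesis by blast
qed

end
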